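(* Let $\mathcal{R}$ be a Lie conformal superalgebra over $\mathbb{C}$, let $\alpha\in\{\bar0,\bar1\}$ and let $A,B,C,D\in\mathbb{C}$. Then there exist $\delta,\delta'\in\mathbb{C}$ such that the space $\Phi(A,B,C,D)_\alpha$ of $(A,B,C,D)$-derivations of degree $\alpha$ of $\mathcal{R}$ is isomorphic (as a $\mathbb{C}[\partial]$-module) to the degree $\alpha$ part of one of the following: (1) $\Phi(\delta,0,0,1)$, (2) $\Phi(\delta,0,0,0)$, (3) $\Phi(\delta,1,-1,1)$, (4) $\Phi(\delta,1,-1,0)$, (5) $\Phi(\delta,1,0,\delta')$, (6) $\Phi(\delta,1,0,0)$, (7) $\Phi(\delta,1,1,\delta')$, (8) $\Phi(\delta,1,1,0)$.
   Context: All vector spaces are over $\mathbb{C}$. A Lie conformal superalgebra is a $\mathbb{Z}_2$-graded $\mathbb{C}[\partial]$-module $\mathcal{R}=\mathcal{R}_{\bar 0}\oplus\mathcal{R}_{\bar 1}$ with a $\mathbb{C}$-linear map $\mathcal{R}\otimes\mathcal{R}\to\mathbb{C}[\lambda]\otimes\mathcal{R}$, $a\otimes b\mapsto[a_\lambda b]$, compatible with the grading (the bracket of elements of parities $i,j$ has coefficients of parity $i+j$), such that for homogeneous $a,b,c$ (with parities $|a|,|b|,|c|$): $[\partial a_\lambda b]=-\lambda[a_\lambda b]$, $[a_\lambda\partial b]=(\partial+\lambda)[a_\lambda b]$; $[a_\lambda b]=-(-1)^{|a||b|}[b_{-\lambda-\partial}a]$; $[a_\lambda[b_\mu c]]=[[a_\lambda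 b]_{\lambda+\mu}c]+(-1)^{|a||b|}[b_\mu[a_\lambda c]]$. A conformal linear map of degree $\alpha\in\{\bar 0,\bar 1\}$ on $\mathcal{R}$ is a $\mathbb{C}$-linear map $\phi_x:\mathcal{R}\to\mathbb{C}[x]\otimes\mathcal{R}$ with $\phi_x(\partial a)=(\partial+x)\phi_x(a)$ and $\phi_x(\mathcal{R}_\beta)\subseteq\mathcal{R}_{\alpha+\beta}[x]$; write $|\phi|=\alpha$. $gc(\mathcal{R})=gc(\mathcal R)_{\bar0}\oplus gc(\mathcal R)_{\bar1}$ denotes the space of all conformal linear maps on $\mathcal{R}$, a $\mathbb{C}[\partial]$-module via $(\partial\phi)_x=-x\phi_x$. Brackets and conformal linear maps are extended coefficientwise to polynomials in the formal variables. For $A,B,C,D\in\mathbb{C}$, an $(A,B,C,D)$-derivation of degree $\alpha$ of $\mathcal{R}$ is $\phi_x\in gc(\mathcal{R})_\alpha$ such that for all homogeneous $a,b,c\in\mathcal{R}$ $$A\phi_x([[a_\lambda b]_{\lambda+\mu}c])=B[[\phi_x(a)_{\lambda+x}b]_{\lambda+\mu+x}c]+(-1)^{|\phi||a|}C[[a_\lambda\phi_x(b)]_{\lambda+\mu+x}c]+(-1)^{|\phi|(|a|+|b|)}D[[a_\lambda b]_{\lambda+\mu}\phi_x(c)].$$ $\Phi(A,B,C,D)_\alpha$ is the set of these and $\Phi(A,B,C,D)=\Phi(A,B,C,D)_{\bar0}\oplus\Phi(A,B,C,D)_{\bar1}$. *)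

theory Defs
  imports Complex_Main "HOL-Library.Poly_Mapping" "HOL-Library.Z2"
    "HOL-Computational_Algebra.Polynomial"
begin

text \<open>
  A \<open>\<complex>[\<partial>]\<close>-module is a complex vector space (scalar multiplication \<open>sc\<close>, carrier the whole type)
  with an endomorphism \<open>dd\<close>, the action of \<open>\<partial>\<close>. The type \<open>'a poly\<close> plays the role of
  \<open>\<complex>[\<lambda>] \<otimes> R\<close> (and of \<open>\<complex>[x] \<otimes> R\<close>); multiplication by the variable is \<open>pCons 0\<close>.
  Parities are elements of the two-element field \<open>bit\<close>.
\<close>

datatype fvar = Lam | Mu | Xvar

type_synonym cpol = "(fvar \<Rightarrow>\<^sub>0 nat) \<Rightarrow>\<^sub>0 complex"   \<comment> \<open>\<open>\<complex>[\<lambda>,\<mu>,x]\<close>\<close>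
type_synonym 'a vpol = "(fvar \<Rightarrow>\<^sub>0 nat) \<Rightarrow>\<^sub>0 'a"      \<comment> \<open>\<open>\<complex>[\<lambda>,\<mu>,x] \<otimes> R\<close>\<close>

definition fv :: "fvar \<Rightarrow> cpol" where
  "fv v = Poly_Mapping.single (Poly_Mapping.single v 1) 1"

abbreviation lam :: cpol where "lam \<equiv> fv Lam"
abbreviation mu :: cpol where "mu \<equiv> fv Mu"
abbreviation xx :: cpol where "xx \<equiv> fv Xvar"

abbreviation cnst :: "'b::zero \<Rightarrow> (fvar \<Rightarrow>\<^sub>0 nat) \<Rightarrow>\<^sub>0 'b" where
  "cnst \<equiv> Poly_Mapping.single 0"

definition psign :: "bit \<Rightarrow> complex" where
  "psign i = (if i = 1 then - 1 else 1)"

definition smul :: "(complex \<Rightarrow> 'a \<Rightarrow> 'a) \<Rightarrow> cpol \<Rightarrow> 'a::ab_group_add vpol \<Rightarrow> 'a vpol" where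
  "smul sc p u = (\<Sum>m\<in>Poly_Mapping.keys p. \<Sum>n\<in>Poly_Mapping.keys u.
     Poly_Mapping.single (m + n) (sc (Poly_Mapping.lookup p m) (Poly_Mapping.lookup u n)))"

text \<open>Replacing the variable of a one-variable polynomial \<open>q\<close> over \<open>R\<close> by \<open>p \<in> \<complex>[\<lambda>,\<mu>,x]\<close>.\<close>

definition subst_var :: "(complex \<Rightarrow> 'a \<Rightarrow> 'a) \<Rightarrow> cpol \<Rightarrow> 'a::ab_group_add poly \<Rightarrow> 'a vpol" where
  "subst_var sc p q = (\<Sum>j\<le>degree q. smul sc (p ^ j) (cnst (coeff q j)))"

text \<open>\<open>[u\<^sub>p v]\<close> and \<open>\<phi>\<^sub>p(u)\<close> for \<open>u, v\<close> with polynomial coefficients: the coefficientwise extensions.\<close>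

definition ebr :: "(complex \<Rightarrow> 'a \<Rightarrow> 'a) \<Rightarrow> ('a \<Rightarrow> 'a \<Rightarrow> 'a poly) \<Rightarrow> 'a::ab_group_add vpol \<Rightarrow> cpol
    \<Rightarrow> 'a vpol \<Rightarrow> 'a vpol" where
  "ebr sc br u p v = (\<Sum>m\<in>Poly_Mapping.keys u. \<Sum>n\<in>Poly_Mapping.keys v.
     smul sc (Poly_Mapping.single (m + n) 1)
       (subst_var sc p (br (Poly_Mapping.lookup u m) (Poly_Mapping.lookup v n))))"

definition emap :: "(complex \<Rightarrow> 'a \<Rightarrow> 'a) \<Rightarrow> ('a \<Rightarrow> 'a poly) \<Rightarrow> cpol
    \<Rightarrow> 'a::ab_group_add vpol \<Rightarrow> 'a vpol" where
  "emap sc \<phi> p u = (\<Sum>m\<in>Poly_Mapping.keys u.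
     smul sc (Poly_Mapping.single m 1) (subst_var sc p (\<phi> (Poly_Mapping.lookup u m))))"

text \<open>The substitution \<open>\<lambda> \<mapsto> - \<lambda> - \<partial>\<close>, with \<open>\<partial>\<close> acting on the coefficients.\<close>

definition subst_skew :: "('a \<Rightarrow> 'a) \<Rightarrow> 'a::ab_group_add poly \<Rightarrow> 'a poly" where
  "subst_skew dd q =
     (\<Sum>n\<le>degree q. ((\<lambda>r. - pCons 0 r - map_poly dd r) ^^ n) [:coeff q n:])"

locale lie_conformal_superalgebra =
  fixes sc :: "complex \<Rightarrow> 'a::ab_group_add \<Rightarrow> 'a"
    and dd :: "'a \<Rightarrow> 'a"
    and G :: "bit \<Rightarrow> 'a set"
    and br :: "'a \<Rightarrow> 'a \<Rightarrow> 'a poly"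
  assumes vector_space: "vector_space sc"
    and dd_linear: "Vector_Spaces.linear sc sc dd"
    and grade_subspace: "module.subspace sc (G i)"
    and grade_dd: "a \<in> G i \<Longrightarrow> dd a \<in> G i"
    and grade_Int: "G 0 \<inter> G 1 = {0}"
    and grade_sum: "\<exists>a0\<in>G 0. \<exists>a1\<in>G 1. a = a0 + a1"
    and br_linear_left: "Vector_Spaces.linear sc (\<lambda>c. map_poly (sc c)) (\<lambda>a. br a b)"
    and br_linear_right: "Vector_Spaces.linear sc (\<lambda>c. map_poly (sc c)) (\<lambda>b. br a b)"
    and br_grade: "a \<in> G i \<Longrightarrow> b \<in> G j \<Longrightarrow> coeff (br a b) n \<in> G (i + j)"
    and br_dd_left: "a \<in> G i \<Longrightarrow> b \<in> G j \<Longrightarrow> br (dd a) b = - pCons 0 (br a b)"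
    and br_dd_right: "a \<in> G i \<Longrightarrow> b \<in> G j \<Longrightarrow>
      br a (dd b) = map_poly dd (br a b) + pCons 0 (br a b)"
    and br_skew: "a \<in> G i \<Longrightarrow> b \<in> G j \<Longrightarrow>
      br a b = - map_poly (sc (psign (i * j))) (subst_skew dd (br b a))"
    and br_jacobi: "a \<in> G i \<Longrightarrow> b \<in> G j \<Longrightarrow> c \<in> G k \<Longrightarrow>
      ebr sc br (cnst a) lam (ebr sc br (cnst b) mu (cnst c)) =
      ebr sc br (ebr sc br (cnst a) lam (cnst b)) (lam + mu) (cnst c)
      + smul sc (cnst (psign (i * j)))
          (ebr sc br (cnst b) mu (ebr sc br (cnst a) lam (cnst c)))"

definition gc :: "(complex \<Rightarrow> 'a \<Rightarrow> 'a) \<Rightarrow> ('a \<Rightarrow> 'a) \<Rightarrow> (bit \<Rightarrow> 'a set) \<Rightarrow> bit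
    \<Rightarrow> ('a::ab_group_add \<Rightarrow> 'a poly) set" where
  "gc sc dd G \<alpha> = {\<phi>. Vector_Spaces.linear sc (\<lambda>c. map_poly (sc c)) \<phi> \<and>
     (\<forall>a. \<phi> (dd a) = map_poly dd (\<phi> a) + pCons 0 (\<phi> a)) \<and>
     (\<forall>\<beta>. \<forall>a\<in>G \<beta>. \<forall>n. coeff (\<phi> a) n \<in> G (\<alpha> + \<beta>))}"

definition gc_add :: "('a \<Rightarrow> 'a poly) \<Rightarrow> ('a \<Rightarrow> 'a poly) \<Rightarrow> 'a::ab_group_add \<Rightarrow> 'a poly" where
  "gc_add \<phi> \<psi> = (\<lambda>a. \<phi> a + \<psi> a)"

definition gc_scale :: "(complex \<Rightarrow> 'a \<Rightarrow> 'a) \<Rightarrow> complex \<Rightarrow> ('a \<Rightarrow> 'a poly)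
    \<Rightarrow> 'a::ab_group_add \<Rightarrow> 'a poly" where
  "gc_scale sc c \<phi> = (\<lambda>a. map_poly (sc c) (\<phi> a))"

definition gc_dd :: "('a \<Rightarrow> 'a poly) \<Rightarrow> 'a::ab_group_add \<Rightarrow> 'a poly" where
  "gc_dd \<phi> = (\<lambda>a. - pCons 0 (\<phi> a))"

text \<open>Isomorphism of \<open>\<complex>[\<partial>]\<close>-submodules \<open>S\<close>, \<open>S'\<close> of \<open>gc(R)\<close>.\<close>

definition gc_isomorphic :: "(complex \<Rightarrow> 'a \<Rightarrow> 'a) \<Rightarrow> ('a::ab_group_add \<Rightarrow> 'a poly) set
    \<Rightarrow> ('a \<Rightarrow> 'a poly) set \<Rightarrow> bool" where
  "gc_isomorphic sc S S' \<longleftrightarrow> (\<exists>F. bij_betw F S S' \<and>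
     (\<forall>\<phi>\<in>S. \<forall>\<psi>\<in>S. F (gc_add \<phi> \<psi>) = gc_add (F \<phi>) (F \<psi>)) \<and>
     (\<forall>c. \<forall>\<phi>\<in>S. F (gc_scale sc c \<phi>) = gc_scale sc c (F \<phi>)) \<and>
     (\<forall>\<phi>\<in>S. F (gc_dd \<phi>) = gc_dd (F \<phi>)))"

definition Phi :: "(complex \<Rightarrow> 'a \<Rightarrow> 'a) \<Rightarrow> ('a \<Rightarrow> 'a) \<Rightarrow> (bit \<Rightarrow> 'a set) \<Rightarrow> ('a \<Rightarrow> 'a \<Rightarrow> 'a poly)
    \<Rightarrow> bit \<Rightarrow> complex \<Rightarrow> complex \<Rightarrow> complex \<Rightarrow> complex \<Rightarrow> ('a::ab_group_add \<Rightarrow> 'a poly) set" where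
  "Phi sc dd G br \<alpha> A B C D = {\<phi> \<in> gc sc dd G \<alpha>.
     \<forall>i j k. \<forall>a\<in>G i. \<forall>b\<in>G j. \<forall>c\<in>G k.
       smul sc (cnst A)
         (emap sc \<phi> xx (ebr sc br (ebr sc br (cnst a) lam (cnst b)) (lam + mu) (cnst c))) =
       smul sc (cnst B)
         (ebr sc br (ebr sc br (emap sc \<phi> xx (cnst a)) (lam + xx) (cnst b)) (lam + mu + xx) (cnst c))
       + smul sc (cnst (psign (\<alpha> * i) * C))
         (ebr sc br (ebr sc br (cnst a) lam (emap sc \<phi> xx (cnst b))) (lam + mu + xx) (cnst c))
       + smul sc (cnst (psign (\<alpha> * (i + j)) * D))
         (ebr sc br (ebr sc br (cnst a) lam (cnst b)) (lam + mu) (emap sc \<phi> xx (cnst c)))}"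

end

theory Submission imports Defs begin

text \<open>
  Exchanging \<open>a\<close> and \<open>b\<close> (and \<open>\<lambda>\<close> and \<open>\<mu>\<close>) in the defining identity and applying skew-symmetry to
  every inner bracket shows \<open>\<Phi>(A,B,C,D) = \<Phi>(A,C,B,D)\<close>. Hence the identity may be replaced by any
  linear combination of itself and its exchanged form, i.e. \<open>(A,B,C,D)\<close> by
  \<open>((s+t)A, sB+tC, sC+tB, (s+t)D)\<close>. On \<open>(B,C)\<close> this acts by \<open>s+t\<close> on the symmetric part and by
  \<open>s-t\<close> on the antisymmetric part, and according to which of the two parts vanish the parameters
  are normalised to one of the listed forms. The isomorphisms are therefore equalities.
\<close>


text \<open>The \<open>single\<close> case ranges only over the coefficients of the given
  \<open>f\<close>. Knowledge about those coefficients, such as their parity, therefore stays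
  available during the induction.\<close>

lemma poly_mapping_induct_lookup [case_names zero single add]:
  fixes f :: "'k \<Rightarrow>\<^sub>0 'b::comm_monoid_add"
  assumes zero: "P 0"
    and single: "\<And>k. P (Poly_Mapping.single k (Poly_Mapping.lookup f k))"
    and add: "\<And>g h. P g \<Longrightarrow> P h \<Longrightarrow> P (g + h)"
  shows "P f"
proof -
  have "P (\<Sum>k\<in>I. Poly_Mapping.single k (Poly_Mapping.lookup f k))" if "finite I" for I
    using that by induction (auto intro: zero single add)
  moreover have "(\<Sum>k\<in>Poly_Mapping.keys f. Poly_Mapping.single k (Poly_Mapping.lookup f k)) = f"
    by (rule poly_mapping_eqI) (auto simp: lookup_sum lookup_single when_def in_keys_iff)
  ultimately show ?thesis by (metis finite_keys)
qed

section \<open>Polynomials with vector coefficients, substitution, extended conformal linear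
  maps\<close>

locale complex_vector_space = vector_space sc for sc :: "complex \<Rightarrow> 'a::ab_group_add \<Rightarrow> 'a"
begin

abbreviation conformal_linear :: "('a \<Rightarrow> 'a poly) \<Rightarrow> bool" where
  "conformal_linear \<equiv> Vector_Spaces.linear sc (\<lambda>c. map_poly (sc c))"

lemma smul_zero_left [simp]: "smul sc 0 u = 0"
  and smul_zero_right [simp]: "smul sc p 0 = 0"
  by (simp_all add: smul_def)

lemma smul_single: "smul sc (Poly_Mapping.single m c) (Poly_Mapping.single n a)
    = Poly_Mapping.single (m + n) (sc c a)"
  by (auto simp: smul_def)

lemma smul_add_right: "smul sc p (u + v) = smul sc p u + smul sc p v"
  unfolding smul_def
  by (subst setsum_keys_plus_distrib) (simp_all add: single_add scale_right_distrib sum.distrib)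

lemma smul_add_left: "smul sc (p + q) u = smul sc p u + smul sc q u"
  unfolding smul_def
  by (rule setsum_keys_plus_distrib) (simp_all add: single_add scale_left_distrib sum.distrib)

lemma smul_smul: "smul sc p (smul sc q u) = smul sc (p * q) u"
proof (induction p rule: poly_mapping_induct_lookup)
  case (single k)
  show ?case
  proof (induction q rule: poly_mapping_induct_lookup)
    case (single l)
    show ?case
      by (induction u rule: poly_mapping_induct_lookup)
        (simp_all add: smul_single mult_single smul_add_right add.assoc)
  qed (simp_all add: smul_add_left smul_add_right distrib_left)
qed (simp_all add: smul_add_left distrib_right)

lemma smul_one [simp]: "smul sc 1 u = u"
  unfolding single_one[symmetric]
  by (induction u rule: poly_mapping_induct_lookup)
    (simp_all add: smul_single smul_add_right del: single_one)

sublocale vpol: module "smul sc"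
  by unfold_locales (simp_all add: smul_add_left smul_add_right smul_smul)

lemma lookup_smul_cnst: "Poly_Mapping.lookup (smul sc p (cnst a)) k = sc (Poly_Mapping.lookup p k) a"
  by (induction p rule: poly_mapping_induct_lookup)
    (auto simp: smul_single vpol.scale_left_distrib lookup_add scale_left_distrib lookup_single when_def)

text \<open>Coefficients beyond the degree vanish. A free bound \<open>N\<close> lets polynomials of
  different degrees share one summation range, which additivity needs because the degree of a sum
  may drop.\<close>

lemma subst_var_degree_le:
  assumes "degree q \<le> N"
  shows "subst_var sc p q = (\<Sum>j\<le>N. smul sc (p ^ j) (cnst (coeff q j)))"
  unfolding subst_var_def using assms
  by (intro sum.mono_neutral_left) (auto simp: coeff_eq_0)

lemma subst_var_add: "subst_var sc p (q + r) = subst_var sc p q + subst_var sc p r"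
proof -
  have "degree (q + r) \<le> max (degree q) (degree r)"
    by (rule degree_add_le_max)
  then show ?thesis
    by (simp add: subst_var_degree_le[of _ "max (degree q) (degree r)"] single_add
        vpol.scale_right_distrib sum.distrib)
qed

lemma subst_var_scale:
  "subst_var sc p (map_poly (sc c) q) = smul sc (cnst c) (subst_var sc p q)"
proof -
  have "degree (map_poly (sc c) q) \<le> degree q"
    by (rule degree_le) (simp add: coeff_map_poly coeff_eq_0)
  \<comment> \<open>The reversed instance of \<open>smul_single\<close> splits
    \<open>cnst (sc c a)\<close> into \<open>smul sc (cnst c) (cnst a)\<close>, so that
    \<open>c\<close> can be pulled out of the sum.\<close>
  then show ?thesis
    by (simp add: subst_var_degree_le[of _ "degree q"] coeff_map_poly vpol.scale_sum_right
        smul_single[of 0 c 0, simplified, symmetric] mult.commute)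
qed

lemma subst_var_zero [simp]: "subst_var sc p 0 = 0"
  by (simp add: subst_var_def)

lemma subst_var_minus: "subst_var sc p (- q) = - subst_var sc p q"
  using subst_var_add[of p q "- q"] by (simp add: eq_neg_iff_add_eq_0 add.commute)

text \<open>Horner's rule: it makes substitution accessible to induction over \<open>pCons\<close>
  and to the sesquilinearity axioms, which are phrased with \<open>pCons 0\<close>.\<close>

lemma subst_var_pCons:
  "subst_var sc p (pCons a q) = cnst a + smul sc p (subst_var sc p q)"
proof -
  have "subst_var sc p (pCons a q)
      = (\<Sum>j\<le>Suc (degree q). smul sc (p ^ j) (cnst (coeff (pCons a q) j)))"
    by (intro subst_var_degree_le degree_pCons_le)
  also have "\<dots> = cnst a + (\<Sum>j\<le>degree q. smul sc (p * p ^ j) (cnst (coeff q j)))"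
    by (subst sum.atMost_Suc_shift) simp
  finally show ?thesis
    by (simp add: subst_var_def vpol.scale_sum_right)
qed

lemma emap_zero [simp]: "emap sc \<phi> p 0 = 0"
  by (simp add: emap_def)

context
  fixes \<phi> :: "'a \<Rightarrow> 'a poly"
  assumes \<phi>: "conformal_linear \<phi>"
begin

interpretation \<phi>: Vector_Spaces.linear sc "\<lambda>c. map_poly (sc c)" \<phi>
  by (rule \<phi>)

lemma emap_single:
  "emap sc \<phi> p (Poly_Mapping.single m a)
    = smul sc (Poly_Mapping.single m 1) (subst_var sc p (\<phi> a))"
  by (cases "a = 0") (simp_all add: emap_def \<phi>.zero)

lemma emap_add: "emap sc \<phi> p (u + v) = emap sc \<phi> p u + emap sc \<phi> p v"
  unfolding emap_def
  by (rule setsum_keys_plus_distrib)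
    (simp_all add: \<phi>.zero \<phi>.add subst_var_add vpol.scale_right_distrib)

lemma emap_smul: "emap sc \<phi> p (smul sc q u) = smul sc q (emap sc \<phi> p u)"
proof (induction q rule: poly_mapping_induct_lookup)
  case (single k)
  show ?case
    by (induction u rule: poly_mapping_induct_lookup)
      (simp_all add: emap_single smul_single \<phi>.scale subst_var_scale mult_single emap_add
        vpol.scale_right_distrib)
qed (simp_all add: emap_add vpol.scale_left_distrib)


lemma emap_cnst: "emap sc \<phi> p (cnst a) = subst_var sc p (\<phi> a)"
  by (simp add: emap_single)

end

end

section \<open>The involution exchanging two formal variables\<close>

text \<open>
  The identity defining \<open>Phi\<close> is stated for the fixed variables \<open>lam\<close> and \<open>mu\<close>, so exchanging the
  roles of \<open>\<lambda>\<close> and \<open>\<mu>\<close> requires the automorphism renaming them.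
\<close>

definition swap_fvar :: "fvar \<Rightarrow> fvar" where
  "swap_fvar v = (case v of Lam \<Rightarrow> Mu | Mu \<Rightarrow> Lam | Xvar \<Rightarrow> Xvar)"

text \<open>\<open>map_key\<close> precomposes with the renaming, provided it is injective. As the
  renaming is its own inverse, this agrees with pushing exponents forward along it.\<close>

definition swap_monom :: "(fvar \<Rightarrow>\<^sub>0 nat) \<Rightarrow> fvar \<Rightarrow>\<^sub>0 nat" where
  "swap_monom = Poly_Mapping.map_key swap_fvar"

definition swap_lam_mu :: "((fvar \<Rightarrow>\<^sub>0 nat) \<Rightarrow>\<^sub>0 'b::zero) \<Rightarrow> (fvar \<Rightarrow>\<^sub>0 nat) \<Rightarrow>\<^sub>0 'b" where
  "swap_lam_mu = Poly_Mapping.map_key swap_monom"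

lemma swap_fvar_swap_fvar [simp]: "swap_fvar (swap_fvar v) = v"
  by (simp add: swap_fvar_def split: fvar.splits)

lemma inj_swap_fvar: "inj swap_fvar"
  by (metis injI swap_fvar_swap_fvar)

lemma swap_monom_swap_monom [simp]: "swap_monom (swap_monom m) = m"
  by (simp add: swap_monom_def map_key_compose[OF inj_swap_fvar inj_swap_fvar] comp_def map_key_id)

lemma inj_swap_monom: "inj swap_monom"
  by (metis injI swap_monom_swap_monom)

lemma swap_monom_zero [simp]: "swap_monom 0 = 0"
  by (simp add: swap_monom_def inj_swap_fvar)

lemma swap_monom_add: "swap_monom (m + n) = swap_monom m + swap_monom n"
  by (simp add: swap_monom_def map_key_plus inj_swap_fvar)

lemma swap_monom_single: "swap_monom (Poly_Mapping.single v n) = Poly_Mapping.single (swap_fvar v) n"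
  using map_key_single[OF inj_swap_fvar, of "swap_fvar v" n] by (simp add: swap_monom_def)

lemma swap_lam_mu_zero [simp]: "swap_lam_mu 0 = 0"
  by (simp add: swap_lam_mu_def inj_swap_monom)

lemma swap_lam_mu_add: "swap_lam_mu (u + v) = swap_lam_mu u + swap_lam_mu v"
  by (simp add: swap_lam_mu_def map_key_plus inj_swap_monom)

lemma swap_lam_mu_sum: "swap_lam_mu (sum f I) = (\<Sum>i\<in>I. swap_lam_mu (f i))"
  by (induction I rule: infinite_finite_induct) (simp_all add: swap_lam_mu_add)

lemma swap_lam_mu_single:
  "swap_lam_mu (Poly_Mapping.single m a) = Poly_Mapping.single (swap_monom m) a"
  using map_key_single[OF inj_swap_monom, of "swap_monom m" a] by (simp add: swap_lam_mu_def)

lemma swap_lam_mu_fv: "swap_lam_mu (fv v) = fv (swap_fvar v)"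
  by (simp add: fv_def swap_lam_mu_single swap_monom_single)

lemma swap_lam_mu_mult: "swap_lam_mu (p * q) = swap_lam_mu p * swap_lam_mu (q :: cpol)"
proof (induction p rule: poly_mapping_induct_lookup)
  case (single k)
  show ?case
    by (induction q rule: poly_mapping_induct_lookup)
      (simp_all add: mult_single swap_lam_mu_single swap_monom_add swap_lam_mu_add distrib_left)
qed (simp_all add: swap_lam_mu_add distrib_right)

lemma swap_lam_mu_one: "swap_lam_mu 1 = (1 :: cpol)"
  using swap_lam_mu_single[of 0 "1 :: complex"] by simp

lemma swap_lam_mu_power: "swap_lam_mu (p ^ n) = swap_lam_mu (p :: cpol) ^ n"
  by (induction n) (simp_all add: swap_lam_mu_mult swap_lam_mu_one)

context complex_vector_space
begin

lemma swap_lam_mu_smul: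
  "swap_lam_mu (smul sc p u) = smul sc (swap_lam_mu p) (swap_lam_mu u)"
proof (induction p rule: poly_mapping_induct_lookup)
  case (single k)
  show ?case
    by (induction u rule: poly_mapping_induct_lookup)
      (simp_all add: smul_single swap_lam_mu_single swap_monom_add swap_lam_mu_add
        vpol.scale_right_distrib)
qed (simp_all add: swap_lam_mu_add vpol.scale_left_distrib)

lemma swap_lam_mu_subst_var:
  "swap_lam_mu (subst_var sc p q) = subst_var sc (swap_lam_mu p) q"
  by (simp add: subst_var_def swap_lam_mu_sum swap_lam_mu_smul swap_lam_mu_power swap_lam_mu_single)

lemma swap_lam_mu_emap:
  assumes "conformal_linear \<phi>"
  shows "swap_lam_mu (emap sc \<phi> p u) = emap sc \<phi> (swap_lam_mu p) (swap_lam_mu u)"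
  by (induction u rule: poly_mapping_induct_lookup)
    (simp_all add: emap_single[OF assms] emap_add[OF assms] swap_lam_mu_add swap_lam_mu_single
      swap_lam_mu_smul swap_lam_mu_subst_var)

end

section \<open>Extended brackets and skew-symmetry inside an outer bracket\<close>

context lie_conformal_superalgebra
begin

sublocale complex_vector_space sc
  using vector_space by (simp add: complex_vector_space_def)

lemma br_zero_left [simp]: "br 0 b = 0"
  and br_zero_right [simp]: "br a 0 = 0"
  and br_add_left: "br (a + a') b = br a b + br a' b"
  and br_add_right: "br a (b + b') = br a b + br a b'"
  and br_scale_left: "br (sc r a) b = map_poly (sc r) (br a b)"
proof -
  interpret l: Vector_Spaces.linear sc "\<lambda>c. map_poly (sc c)" "\<lambda>a. br a b" for b
    by (rule br_linear_left)
  interpret r: Vector_Spaces.linear sc "\<lambda>c. map_poly (sc c)" "\<lambda>b. br a b" for a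
    by (rule br_linear_right)
  show "br 0 b = 0" "br a 0 = 0" "br (a + a') b = br a b + br a' b"
    "br a (b + b') = br a b + br a b'" "br (sc r a) b = map_poly (sc r) (br a b)"
    by (simp_all add: l.add r.add l.scale)
qed

lemma dd_zero [simp]: "dd 0 = 0" and dd_add: "dd (a + b) = dd a + dd b"
proof -
  interpret Vector_Spaces.linear sc sc dd by (rule dd_linear)
  show "dd 0 = 0" "dd (a + b) = dd a + dd b" by (simp_all add: add)
qed

text \<open>The axiom speaks of homogeneous elements; decomposing both arguments by parity and using
  biadditivity extends it to all elements.\<close>

lemma br_dd: "br (dd a) b = - pCons 0 (br a b)"
proof -
  obtain a0 a1 where a: "a0 \<in> G 0" "a1 \<in> G 1" "a = a0 + a1"
    using grade_sum by blast
  obtain b0 b1 where b: "b0 \<in> G 0" "b1 \<in> G 1" "b = b0 + b1"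
    using grade_sum by blast
  \<comment> \<open>Oriented so as to split sums under \<open>pCons 0\<close>. The simp rule
    \<open>add_pCons\<close> works in the opposite direction and is disabled below.\<close>
  have "pCons 0 (q + r) = pCons 0 q + pCons 0 r" for q r :: "'a poly"
    by simp
  then show ?thesis
    by (simp add: a b br_add_left br_add_right dd_add br_dd_left[OF a(1) b(1)]
        br_dd_left[OF a(1) b(2)] br_dd_left[OF a(2) b(1)] br_dd_left[OF a(2) b(2)] del: add_pCons)
qed

lemma ebr_zero_left [simp]: "ebr sc br 0 p v = 0"
  and ebr_zero_right [simp]: "ebr sc br u p 0 = 0"
  by (simp_all add: ebr_def)

lemma ebr_single:
  "ebr sc br (Poly_Mapping.single m a) p (Poly_Mapping.single n b)
    = smul sc (Poly_Mapping.single (m + n) 1) (subst_var sc p (br a b))"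
  by (auto simp: ebr_def)

lemma ebr_add_left: "ebr sc br (u + u') p v = ebr sc br u p v + ebr sc br u' p v"
  unfolding ebr_def
  by (rule setsum_keys_plus_distrib)
    (simp_all add: br_add_left subst_var_add vpol.scale_right_distrib sum.distrib)

lemma ebr_add_right: "ebr sc br u p (v + v') = ebr sc br u p v + ebr sc br u p v'"
  unfolding ebr_def
  by (subst setsum_keys_plus_distrib)
    (simp_all add: br_add_right subst_var_add vpol.scale_right_distrib sum.distrib)

lemma ebr_smul_left: "ebr sc br (smul sc q u) p v = smul sc q (ebr sc br u p v)"
proof (induction q rule: poly_mapping_induct_lookup)
  case (single k)
  show ?case
  proof (induction u rule: poly_mapping_induct_lookup)
    case (single l)
    show ?case
      by (induction v rule: poly_mapping_induct_lookup)
        (simp_all add: ebr_single smul_single br_scale_left subst_var_scale mult_single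
          ebr_add_right vpol.scale_right_distrib add.assoc)
  qed (simp_all add: ebr_add_left vpol.scale_right_distrib)
qed (simp_all add: ebr_add_left vpol.scale_left_distrib)

lemma ebr_minus_left: "ebr sc br (- u) p v = - ebr sc br u p v"
  using ebr_smul_left[of "- 1" u p v] by (simp add: vpol.scale_minus_left)

lemma swap_lam_mu_ebr:
  "swap_lam_mu (ebr sc br u p v) = ebr sc br (swap_lam_mu u) (swap_lam_mu p) (swap_lam_mu v)"
proof (induction u rule: poly_mapping_induct_lookup)
  case (single k)
  show ?case
    by (induction v rule: poly_mapping_induct_lookup)
      (simp_all add: ebr_single ebr_add_right swap_lam_mu_add swap_lam_mu_single swap_monom_add
        swap_lam_mu_smul swap_lam_mu_subst_var)
qed (simp_all add: ebr_add_left swap_lam_mu_add)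

lemma ebr_cnst_dd: "ebr sc br (cnst (dd a)) s w = - smul sc s (ebr sc br (cnst a) s w)"
  by (induction w rule: poly_mapping_induct_lookup)
    (simp_all add: ebr_single br_dd subst_var_minus subst_var_pCons vpol.scale_minus_right
      mult.commute ebr_add_right vpol.scale_right_distrib)

lemma ebr_subst_var_dd:
  "ebr sc br (subst_var sc p (map_poly dd r)) s w = - smul sc s (ebr sc br (subst_var sc p r) s w)"
  by (induction r)
    (simp_all add: map_poly_pCons subst_var_pCons ebr_add_left ebr_smul_left ebr_cnst_dd
      vpol.scale_right_distrib vpol.scale_minus_right mult.commute)

text \<open>Inside the outer bracket \<open>\<partial>\<close> acts as \<open>-(p + q)\<close>, so that \<open>-p - \<partial>\<close> becomes \<open>q\<close>.\<close>

lemma ebr_subst_skew: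
  "ebr sc br (subst_var sc p (subst_skew dd r)) (p + q) w = ebr sc br (subst_var sc q r) (p + q) w"
proof -
  \<comment> \<open>\<open>?S\<close> is the operator iterated in \<open>subst_skew\<close>;
    \<open>?E\<close> evaluates a polynomial at \<open>p\<close> and places it inside the outer
    bracket.\<close>
  let ?S = "\<lambda>r. - pCons 0 r - map_poly dd r" and ?E = "\<lambda>r. ebr sc br (subst_var sc p r) (p + q) w"
  have S_eq: "?S r = - (pCons 0 r + map_poly dd r)" for r
    by (simp only: minus_add_distrib add_uminus_conv_diff)
  \<comment> \<open>The variable contributes \<open>-p\<close>, and \<open>-\<partial>\<close>
    contributes \<open>p + q\<close> by sesquilinearity of the outer bracket; the sum is
    \<open>q\<close>.\<close>
  have S: "?E (?S r) = smul sc q (?E r)" for r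
    unfolding S_eq subst_var_minus subst_var_add ebr_minus_left ebr_add_left ebr_subst_var_dd
    by (simp add: subst_var_pCons ebr_smul_left vpol.scale_left_distrib)
  have S_pow: "?E ((?S ^^ n) r) = smul sc (q ^ n) (?E r)" for n r
    by (induction n) (simp_all only: funpow.simps comp_apply S id_apply power_0 power_Suc smul_one smul_smul)
  have E_sum: "?E (sum f I) = (\<Sum>i\<in>I. ?E (f i))" for f :: "nat \<Rightarrow> 'a poly" and I
    by (induction I rule: infinite_finite_induct) (simp_all add: subst_var_add ebr_add_left)
  have ebr_sum: "ebr sc br (sum f I) s w = (\<Sum>i\<in>I. ebr sc br (f i) s w)" for f :: "nat \<Rightarrow> 'a vpol" and I s
    by (induction I rule: infinite_finite_induct) (simp_all add: ebr_add_left)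
  \<comment> \<open>\<open>subst_skew\<close> applies powers of \<open>?S\<close> to constant
    polynomials, on which evaluation at \<open>p\<close> has no effect. What remains is the sum over
    powers of \<open>q\<close> that defines evaluation at \<open>q\<close>.\<close>
  show ?thesis
    unfolding subst_skew_def E_sum S_pow
    by (simp add: subst_var_def[of _ q] subst_var_pCons ebr_sum ebr_smul_left)
qed

text \<open>Skew-symmetry introduces the inner variable \<open>-p - \<partial>\<close>, which
  \<open>ebr_subst_skew\<close> replaces by \<open>q\<close>; the monomials only contribute a common
  factor.\<close>

lemma ebr_skew_cnst:
  assumes "a \<in> G i" "b \<in> G j"
  shows "ebr sc br (ebr sc br (Poly_Mapping.single m a) p (Poly_Mapping.single n b)) (p + q) w
    = smul sc (cnst (- psign (i * j)))
        (ebr sc br (ebr sc br (Poly_Mapping.single n b) q (Poly_Mapping.single m a)) (p + q) w)"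
  by (simp add: ebr_single br_skew[OF assms] subst_var_minus subst_var_scale ebr_minus_left
      ebr_smul_left ebr_subst_skew single_uminus mult.commute add.commute[of m])

definition homogeneous :: "bit \<Rightarrow> 'a vpol \<Rightarrow> bool" where
  "homogeneous i u \<longleftrightarrow> (\<forall>m. Poly_Mapping.lookup u m \<in> G i)"

text \<open>Biadditivity reduces this to single terms, and homogeneity ensures that all of them
  carry the same sign. Keeping \<open>s\<close> separate from \<open>p + q\<close> allows uses where
  the outer variable has its summands in another order.\<close>

lemma ebr_skew:
  assumes u: "homogeneous i u" and v: "homogeneous j v" and s: "s = p + q"
  shows "ebr sc br (ebr sc br u p v) s w
    = smul sc (cnst (- psign (i * j))) (ebr sc br (ebr sc br v q u) s w)"
  unfolding s
proof (induction u rule: poly_mapping_induct_lookup)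
  case (single k)
  show ?case
  proof (induction v rule: poly_mapping_induct_lookup)
    case (single l)
    \<comment> \<open>The elements here are coefficients of the original \<open>u\<close> and
      \<open>v\<close>, so homogeneity places them in \<open>G i\<close> and
      \<open>G j\<close>.\<close>
    show ?case
      using u v by (intro ebr_skew_cnst) (auto simp: homogeneous_def)
  qed (simp_all add: ebr_add_left ebr_add_right vpol.scale_right_distrib)
qed (simp_all add: ebr_add_left ebr_add_right vpol.scale_right_distrib)

lemma homogeneous_cnst: "a \<in> G i \<Longrightarrow> homogeneous i (cnst a)"
  using subspace_0[OF grade_subspace[of i]]
  by (simp add: homogeneous_def lookup_single when_def)

lemma homogeneous_emap:
  assumes \<phi>: "\<phi> \<in> gc sc dd G \<alpha>" and a: "a \<in> G i"
  shows "homogeneous (\<alpha> + i) (emap sc \<phi> p (cnst a))"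
proof -
  have "conformal_linear \<phi>" "coeff (\<phi> a) n \<in> G (\<alpha> + i)" for n
    using \<phi> a by (simp_all add: gc_def)
  then show ?thesis
    using grade_subspace[of "\<alpha> + i"]
    by (simp add: emap_cnst homogeneous_def subst_var_def lookup_sum lookup_smul_cnst
        subspace_sum subspace_scale)
qed

section \<open>Symmetry of \<open>Phi\<close> and normal forms of the parameters\<close>

interpretation scalar: module "\<lambda>r. smul sc (cnst r)"
  by unfold_locales
    (simp_all add: vpol.scale_right_distrib vpol.scale_left_distrib single_add mult_single)

text \<open>Reversing the inner brackets turns the term with \<phi> on the first entry into the one
  with \<phi> on the second, and conversely; this is what exchanges \<open>B\<close> and
  \<open>C\<close>. The remaining work is to see that the signs cancel.\<close>

lemma Phi_swap:
  assumes \<phi>: "\<phi> \<in> Phi sc dd G br \<alpha> A B C D"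
  shows "\<phi> \<in> Phi sc dd G br \<alpha> A C B D"
proof -
  have gc: "\<phi> \<in> gc sc dd G \<alpha>"
    using \<phi> by (simp add: Phi_def)
  then have lin: "conformal_linear \<phi>"
    by (simp add: gc_def)
  note hom = homogeneous_cnst homogeneous_emap[OF gc]
  have "smul sc (cnst A)
         (emap sc \<phi> xx (ebr sc br (ebr sc br (cnst a) lam (cnst b)) (lam + mu) (cnst c))) =
       smul sc (cnst C)
         (ebr sc br (ebr sc br (emap sc \<phi> xx (cnst a)) (lam + xx) (cnst b)) (lam + mu + xx) (cnst c))
       + smul sc (cnst (psign (\<alpha> * i) * B))
         (ebr sc br (ebr sc br (cnst a) lam (emap sc \<phi> xx (cnst b))) (lam + mu + xx) (cnst c))
       + smul sc (cnst (psign (\<alpha> * (i + j)) * D))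
         (ebr sc br (ebr sc br (cnst a) lam (cnst b)) (lam + mu) (emap sc \<phi> xx (cnst c)))"
    (is "smul sc _ ?X0 = smul sc _ ?X1 + smul sc _ ?X2 + smul sc _ ?X3")
    if abc: "a \<in> G i" "b \<in> G j" "c \<in> G k" for a b c i j k
  proof -
    \<comment> \<open>This is the defining identity for the triple \<open>b\<close>,
      \<open>a\<close>, \<open>c\<close>, before the variables are renamed.\<close>
    let ?lhs = "smul sc (cnst A)
         (emap sc \<phi> xx (ebr sc br (ebr sc br (cnst b) lam (cnst a)) (lam + mu) (cnst c)))"
    let ?rhs = "smul sc (cnst B)
         (ebr sc br (ebr sc br (emap sc \<phi> xx (cnst b)) (lam + xx) (cnst a)) (lam + mu + xx) (cnst c))
       + smul sc (cnst (psign (\<alpha> * j) * C))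
         (ebr sc br (ebr sc br (cnst b) lam (emap sc \<phi> xx (cnst a))) (lam + mu + xx) (cnst c))
       + smul sc (cnst (psign (\<alpha> * (j + i)) * D))
         (ebr sc br (ebr sc br (cnst b) lam (cnst a)) (lam + mu) (emap sc \<phi> xx (cnst c)))"
    have "?lhs = ?rhs"
      using \<phi> abc unfolding Phi_def by blast
    then have "swap_lam_mu ?lhs = swap_lam_mu ?rhs"
      by (rule arg_cong)
    then have eq: "smul sc (cnst A)
         (emap sc \<phi> xx (ebr sc br (ebr sc br (cnst b) mu (cnst a)) (lam + mu) (cnst c))) =
       smul sc (cnst B)
         (ebr sc br (ebr sc br (emap sc \<phi> xx (cnst b)) (mu + xx) (cnst a)) (lam + mu + xx) (cnst c))
       + smul sc (cnst (psign (\<alpha> * j) * C))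
         (ebr sc br (ebr sc br (cnst b) mu (emap sc \<phi> xx (cnst a))) (lam + mu + xx) (cnst c))
       + smul sc (cnst (psign (\<alpha> * (j + i)) * D))
         (ebr sc br (ebr sc br (cnst b) mu (cnst a)) (lam + mu) (emap sc \<phi> xx (cnst c)))"
      by (simp only: swap_lam_mu_add swap_lam_mu_smul swap_lam_mu_ebr swap_lam_mu_emap[OF lin]
          swap_lam_mu_single swap_lam_mu_fv swap_fvar_def fvar.case swap_monom_zero
          add.commute[of mu lam])
    \<comment> \<open>In each reversal the new inner variable is the outer one minus the old inner
      one: \<open>lam\<close> here and in \<open>\<phi>ba\<close>, but \<open>lam + xx\<close> in
      \<open>b\<phi>a\<close>.\<close>
    have ba: "ebr sc br (ebr sc br (cnst b) mu (cnst a)) (lam + mu) w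
        = smul sc (cnst (- psign (j * i))) (ebr sc br (ebr sc br (cnst a) lam (cnst b)) (lam + mu) w)"
      for w
      using abc by (intro ebr_skew hom) (simp_all add: ac_simps)
    have \<phi>ba: "ebr sc br (ebr sc br (emap sc \<phi> xx (cnst b)) (mu + xx) (cnst a)) (lam + mu + xx) (cnst c)
        = smul sc (cnst (- psign ((\<alpha> + j) * i))) ?X2"
      using abc by (intro ebr_skew hom) (simp_all add: ac_simps)
    have b\<phi>a: "ebr sc br (ebr sc br (cnst b) mu (emap sc \<phi> xx (cnst a))) (lam + mu + xx) (cnst c)
        = smul sc (cnst (- psign (j * (\<alpha> + i)))) ?X1"
      using abc by (intro ebr_skew hom) (simp_all add: ac_simps)
    \<comment> \<open>Multiplying by \<open>- psign (j * i)\<close>, which squares to 1, removes the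
      sign that the reversal put on the left-hand side.\<close>
    have "smul sc (cnst (- psign (j * i) * (A * - psign (j * i)))) ?X0
      = smul sc (cnst (- psign (j * i) * (B * - psign ((\<alpha> + j) * i)))) ?X2
      + smul sc (cnst (- psign (j * i) * (psign (\<alpha> * j) * C * - psign (j * (\<alpha> + i))))) ?X1
      + smul sc (cnst (- psign (j * i) * (psign (\<alpha> * (j + i)) * D * - psign (j * i)))) ?X3"
      using arg_cong[OF eq, of "smul sc (cnst (- psign (j * i)))"]
      unfolding ba \<phi>ba b\<phi>a emap_smul[OF lin] scalar.scale_right_distrib scalar.scale_scale .
    \<comment> \<open>Signs multiply as parities add. For instance
      \<open>j * i + (\<alpha> + j) * i\<close> is \<open>\<alpha> * i\<close> modulo 2, and
      \<open>j * i + \<alpha> * j + j * (\<alpha> + i)\<close> is 0.\<close>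
    moreover have "- psign (j * i) * (A * - psign (j * i)) = A"
      "- psign (j * i) * (B * - psign ((\<alpha> + j) * i)) = psign (\<alpha> * i) * B"
      "- psign (j * i) * (psign (\<alpha> * j) * C * - psign (j * (\<alpha> + i))) = C"
      "- psign (j * i) * (psign (\<alpha> * (j + i)) * D * - psign (j * i)) = psign (\<alpha> * (i + j)) * D"
      by (cases \<alpha>; cases i; cases j; simp add: psign_def)+
    ultimately show ?thesis
      by (simp only: add_ac)
  qed
  then show ?thesis
    using gc by (simp add: Phi_def)
qed

text \<open>Add \<open>s\<close> times the identity to \<open>t\<close> times its exchanged form
  from \<open>Phi_swap\<close>.\<close>

lemma Phi_combine:
  assumes "\<phi> \<in> Phi sc dd G br \<alpha> A B C D"
  shows "\<phi> \<in> Phi sc dd G br \<alpha> ((s + t) * A) (s * B + t * C) (s * C + t * B) ((s + t) * D)"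
proof -
  \<comment> \<open>Here \<open>\<epsilon>\<close> and \<open>\<epsilon>'\<close> stand for the
    signs \<open>psign (\<alpha> * i)\<close> and \<open>psign (\<alpha> * (i + j))\<close>, which
    are the same in both identities.\<close>
  have combine: "smul sc (cnst ((s + t) * A)) X0 = smul sc (cnst (s * B + t * C)) X1
      + smul sc (cnst (\<epsilon> * (s * C + t * B))) X2 + smul sc (cnst (\<epsilon>' * ((s + t) * D))) X3"
    if eq: "smul sc (cnst A) X0 = smul sc (cnst B) X1 + smul sc (cnst (\<epsilon> * C)) X2
        + smul sc (cnst (\<epsilon>' * D)) X3"
      and eq': "smul sc (cnst A) X0 = smul sc (cnst C) X1 + smul sc (cnst (\<epsilon> * B)) X2
        + smul sc (cnst (\<epsilon>' * D)) X3"
    for X0 X1 X2 X3 \<epsilon> \<epsilon>'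
  proof -
    have "smul sc (cnst ((s + t) * A)) X0
        = smul sc (cnst s) (smul sc (cnst A) X0) + smul sc (cnst t) (smul sc (cnst A) X0)"
      by (simp only: scalar.scale_scale scalar.scale_left_distrib distrib_right)
    also have "\<dots> = smul sc (cnst s) (smul sc (cnst B) X1 + smul sc (cnst (\<epsilon> * C)) X2
        + smul sc (cnst (\<epsilon>' * D)) X3) + smul sc (cnst t) (smul sc (cnst C) X1
        + smul sc (cnst (\<epsilon> * B)) X2 + smul sc (cnst (\<epsilon>' * D)) X3)"
      by (metis eq eq')
    finally show ?thesis
      by (simp only: scalar.scale_right_distrib scalar.scale_scale scalar.scale_left_distrib
          distrib_left distrib_right ac_simps)
  qed
  show ?thesis
    using assms Phi_swap[OF assms] unfolding Phi_def mem_Collect_eq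
    by (intro conjI allI ballI combine) blast+
qed

text \<open>One combination gives each inclusion; the weights \<open>s'\<close>, \<open>t'\<close>
  undo the change of parameters made by \<open>s\<close>, \<open>t\<close>.\<close>

lemma Phi_eq_if_combine:
  assumes "A' = (s + t) * A" "B' = s * B + t * C" "C' = s * C + t * B" "D' = (s + t) * D"
    and "A = (s' + t') * A'" "B = s' * B' + t' * C'" "C = s' * C' + t' * B'" "D = (s' + t') * D'"
  shows "Phi sc dd G br \<alpha> A B C D = Phi sc dd G br \<alpha> A' B' C' D'"
  using Phi_combine[of _ \<alpha> A B C D s t] Phi_combine[of _ \<alpha> A' B' C' D' s' t']
  unfolding assms(1-4)[symmetric] assms(5-8)[symmetric] by blast

text \<open>Six cases suffice for the eight listed forms, since \<open>generic\<close> and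
  \<open>sym\<close> with \<open>\<delta>' = 0\<close> give the two forms with last parameter
  0.\<close>

lemma Phi_cases:
  obtains (B_C_zero_D) \<delta> where "Phi sc dd G br \<alpha> A B C D = Phi sc dd G br \<alpha> \<delta> 0 0 1"
  | (B_C_D_zero) \<delta> where "Phi sc dd G br \<alpha> A B C D = Phi sc dd G br \<alpha> \<delta> 0 0 0"
  | (antisym_D) \<delta> where "Phi sc dd G br \<alpha> A B C D = Phi sc dd G br \<alpha> \<delta> 1 (- 1) 1"
  | (antisym) \<delta> where "Phi sc dd G br \<alpha> A B C D = Phi sc dd G br \<alpha> \<delta> 1 (- 1) 0"
  | (generic) \<delta> \<delta>' where "Phi sc dd G br \<alpha> A B C D = Phi sc dd G br \<alpha> \<delta> 1 0 \<delta>'"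
  | (sym) \<delta> \<delta>' where "Phi sc dd G br \<alpha> A B C D = Phi sc dd G br \<alpha> \<delta> 1 1 \<delta>'"
proof (cases "B + C = 0")
  case True
  then have C: "C = - B"
    by (simp add: eq_neg_iff_add_eq_0 add.commute)
  consider "B = 0" "D = 0" | "B = 0" "D \<noteq> 0" | "B \<noteq> 0" "D = 0" | "B \<noteq> 0" "D \<noteq> 0"
    by blast
  then show ?thesis
  proof cases
    case 1
    then show ?thesis using B_C_D_zero C by simp
  next
    case 2
    then have "Phi sc dd G br \<alpha> A B C D = Phi sc dd G br \<alpha> (A / D) 0 0 1"
      by (intro Phi_eq_if_combine[where s = "1 / D" and t = 0 and s' = D and t' = 0]) (auto simp: C)
    then show ?thesis by (rule B_C_zero_D)
  next
    case 3
    then have "Phi sc dd G br \<alpha> A B C D = Phi sc dd G br \<alpha> (A / B) 1 (- 1) 0"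
      by (intro Phi_eq_if_combine[where s = "1 / B" and t = 0 and s' = B and t' = 0]) (auto simp: C)
    then show ?thesis by (rule antisym)
  next
    case 4
    then have "Phi sc dd G br \<alpha> A B C D = Phi sc dd G br \<alpha> (A / D) 1 (- 1) 1"
      \<comment> \<open>The weights solve \<open>s + t = 1 / D\<close> and
        \<open>s - t = 1 / B\<close>, normalising \<open>D\<close> and the antisymmetric part
        independently. Their inverses satisfy \<open>s' + t' = D\<close> and
        \<open>s' - t' = B\<close>.\<close>
      by (intro Phi_eq_if_combine[where s = "(1 / D + 1 / B) / 2" and t = "(1 / D - 1 / B) / 2"
            and s' = "(D + B) / 2" and t' = "(D - B) / 2"]) (auto simp: C field_simps)
    then show ?thesis by (rule antisym_D)
  qed
next
  case sum: False
  show ?thesis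
  proof (cases "B = C")
    case True
    \<comment> \<open>Here \<open>B\<close> is nonzero because \<open>B + C\<close> is, so rescaling
      suffices.\<close>
    with sum have "Phi sc dd G br \<alpha> A B C D = Phi sc dd G br \<alpha> (A / B) 1 1 (D / B)"
      by (intro Phi_eq_if_combine[where s = "1 / B" and t = 0 and s' = B and t' = 0]) auto
    then show ?thesis by (rule sym)
  next
    case False
    \<comment> \<open>\<open>N\<close> is the determinant of the system
      \<open>s * B + t * C = 1\<close>, \<open>s * C + t * B = 0\<close>, whose solution is
      \<open>s = B / N\<close>, \<open>t = - C / N\<close>. Starting from the pair (1, 0), the
      weights \<open>B\<close> and \<open>C\<close> lead back.\<close>
    define N where "N = (B + C) * (B - C)"
    have N: "N \<noteq> 0" "B / N + - C / N = 1 / (B + C)" "B / N * B + - C / N * C = 1"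
      using sum False by (auto simp: N_def divide_simps) (auto simp: algebra_simps)
    have "Phi sc dd G br \<alpha> A B C D = Phi sc dd G br \<alpha> (A / (B + C)) 1 0 (D / (B + C))"
      using sum N by (intro Phi_eq_if_combine[where s = "B / N" and t = "- C / N" and s' = B and t' = C])
        auto
    then show ?thesis by (rule generic)
  qed
qed

end

lemma gc_isomorphic_refl: "gc_isomorphic sc S S"
  unfolding gc_isomorphic_def by (rule exI[of _ id]) simp

theorem theorem5p13:
  fixes sc :: "complex \<Rightarrow> 'a::ab_group_add \<Rightarrow> 'a"
    and dd :: "'a \<Rightarrow> 'a"
    and G :: "bit \<Rightarrow> 'a set"
    and br :: "'a \<Rightarrow> 'a \<Rightarrow> 'a poly"
    and \<alpha> :: bit
    and A B C D :: complex
  assumes "lie_conformal_superalgebra sc dd G br"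
  shows "\<exists>\<delta> \<delta>' :: complex.
    let P = Phi sc dd G br \<alpha>; iso = gc_isomorphic sc (P A B C D) in
      iso (P \<delta> 0 0 1) \<or>
      iso (P \<delta> 0 0 0) \<or>
      iso (P \<delta> 1 (- 1) 1) \<or>
      iso (P \<delta> 1 (- 1) 0) \<or>
      iso (P \<delta> 1 0 \<delta>') \<or>
      iso (P \<delta> 1 0 0) \<or>
      iso (P \<delta> 1 1 \<delta>') \<or>
      iso (P \<delta> 1 1 0)"
proof -
  interpret lie_conformal_superalgebra sc dd G br
    by (rule assms)
  show ?thesis
    unfolding Let_def
    \<comment> \<open>Every case is an equality of sets, so the identity map is the isomorphism;
      where only \<delta> occurs, any value of \<open>\<delta>'\<close> will do.\<close>
    by (rule Phi_cases[of \<alpha> A B C D]) (metis gc_isomorphic_refl)+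
qed

end
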